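(* Let $n \ge 10^9$ be an odd integer, let $k$ be an even integer with $\frac{2n}{5} < k < \frac{n}{2}$, and let $G$ be an $n$-vertex $k$-regular graph. If the number of triangles in $G$ is at most $\frac{k}{4}(3k-n-1)$, then $G$ can be made bipartite by deleting at most $\frac{15}{2}k^{3/2}$ edges. *)

theory Defs
  imports Complex_Main
begin

text \<open>Finite simple undirected graphs, given by a vertex set \<open>V\<close> and a set \<open>E\<close> of
  two-element subsets of \<open>V\<close>.\<close>

definition simple_graph :: "'a set \<Rightarrow> 'a set set \<Rightarrow> bool" where
  "simple_graph V E \<longleftrightarrow> finite V \<and> (\<forall>e\<in>E. e \<subseteq> V \<and> card e = 2)"

definition vertex_degree :: "'a set set \<Rightarrow> 'a \<Rightarrow> nat" where
  "vertex_degree E v = card {e \<in> E. v \<in> e}"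

definition regular_graph :: "nat \<Rightarrow> 'a set \<Rightarrow> 'a set set \<Rightarrow> bool" where
  "regular_graph k V E \<longleftrightarrow> simple_graph V E \<and> (\<forall>v\<in>V. vertex_degree E v = k)"

text \<open>A triangle is identified with its set of three vertices, so each one is counted once.\<close>

definition triangles :: "'a set \<Rightarrow> 'a set set \<Rightarrow> 'a set set" where
  "triangles V E =
     {T. T \<subseteq> V \<and> card T = 3 \<and> (\<forall>x\<in>T. \<forall>y\<in>T. x \<noteq> y \<longrightarrow> {x, y} \<in> E)}"

definition bipartite_graph :: "'a set \<Rightarrow> 'a set set \<Rightarrow> bool" where
  "bipartite_graph V E \<longleftrightarrow> simple_graph V E \<and>
     (\<exists>A B. A \<union> B = V \<and> A \<inter> B = {} \<and> (\<forall>e\<in>E. \<exists>a\<in>A. \<exists>b\<in>B. e = {a, b}))"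

end

theory Submission
  imports Defs
begin

text \<open>
  Write \<open>s = \<surd>k\<close>. The number of triangles is \<open>O(k\<^sup>2)\<close>, so deleting the edges that lie in more
  than \<open>10 s\<close> triangles and all edges at vertices whose neighbourhood spans more than \<open>k s / 4\<close> edges
  costs only \<open>O(k s)\<close> edges. The remaining graph has no triangle, and any three of its non-deleted
  vertices include two with a common neighbour, so it is bipartite unless it contains a pentagon.

  Suppose it contains a pentagon. Five vertices in cyclic order satisfy \<open>5 k \<le> 2 n + \<Sigma>\<close>, where \<open>\<Sigma>\<close>
  is the sum of the codegrees of consecutive vertices. As the codegrees along the remaining pentagon
  are small and \<open>5 k > 2 n\<close>, all but \<open>O(s)\<close> vertices are adjacent to exactly two, non-consecutive,
  vertices of the pentagon. This makes \<open>G\<close> a blow-up of a pentagon with parts of size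
  \<open>k / 2 + O(s)\<close>, up to \<open>O(k s)\<close> edges. Since \<open>k\<close> is even, \<open>5 k - 2 n \<ge> 2\<close>, and averaging the
  inequality over transversal pentagons of the blow-up gives about \<open>k\<^sup>2 / 2\<close> as a lower bound for
  three times the number of triangles, against an upper bound of about \<open>3 k\<^sup>2 / 8\<close>.
\<close>

section \<open>Averaging over transversals of five sets\<close>

text \<open>Shrink each set to exactly \<open>m\<close> elements, which by nonnegativity only lowers
  the right-hand side. Summing \<open>lower\<close> over all \<open>m ^ 5\<close> tuples then counts
  every consecutive pair exactly \<open>m ^ 3\<close> times, and dividing by \<open>m ^ 3\<close>
  gives the bound.\<close>

lemma cyclic_product_average:
  fixes g :: "'a \<Rightarrow> 'a \<Rightarrow> real"
  assumes fin: "finite A0" "finite A1" "finite A2" "finite A3" "finite A4"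
    and size: "m \<le> card A0" "m \<le> card A1" "m \<le> card A2" "m \<le> card A3" "m \<le> card A4"
    and nonneg: "\<And>x y. 0 \<le> g x y"
    and lower: "\<And>a b c d e. \<lbrakk>a \<in> A0; b \<in> A1; c \<in> A2; d \<in> A3; e \<in> A4\<rbrakk> \<Longrightarrow>
      r \<le> g a b + g b c + g c d + g d e + g e a"
  shows "r * real m ^ 2 \<le> (\<Sum>a\<in>A0. \<Sum>b\<in>A1. g a b) + (\<Sum>b\<in>A1. \<Sum>c\<in>A2. g b c)
    + (\<Sum>c\<in>A2. \<Sum>d\<in>A3. g c d) + (\<Sum>d\<in>A3. \<Sum>e\<in>A4. g d e) + (\<Sum>e\<in>A4. \<Sum>a\<in>A0. g e a)"
    (is "_ \<le> ?R")
proof (cases "m = 0")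
  case True
  then show ?thesis using nonneg by (simp add: sum_nonneg)
next
  case False
  obtain B0 where B0: "B0 \<subseteq> A0" "card B0 = m" "finite B0"
    using obtain_subset_with_card_n[OF size(1)] by blast
  obtain B1 where B1: "B1 \<subseteq> A1" "card B1 = m" "finite B1"
    using obtain_subset_with_card_n[OF size(2)] by blast
  obtain B2 where B2: "B2 \<subseteq> A2" "card B2 = m" "finite B2"
    using obtain_subset_with_card_n[OF size(3)] by blast
  obtain B3 where B3: "B3 \<subseteq> A3" "card B3 = m" "finite B3"
    using obtain_subset_with_card_n[OF size(4)] by blast
  obtain B4 where B4: "B4 \<subseteq> A4" "card B4 = m" "finite B4"
    using obtain_subset_with_card_n[OF size(5)] by blast
  define M where "M = real m"
  have sub: "(\<Sum>x\<in>B. \<Sum>y\<in>C. g x y) \<le> (\<Sum>x\<in>B'. \<Sum>y\<in>C'. g x y)"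
    if "B \<subseteq> B'" "C \<subseteq> C'" "finite B'" "finite C'" for B B' C C'
  proof -
    have "(\<Sum>x\<in>B. \<Sum>y\<in>C. g x y) \<le> (\<Sum>x\<in>B. \<Sum>y\<in>C'. g x y)"
      using that nonneg by (intro sum_mono sum_mono2) auto
    also have "\<dots> \<le> (\<Sum>x\<in>B'. \<Sum>y\<in>C'. g x y)"
      using that nonneg by (intro sum_mono2) (auto intro: sum_nonneg)
    finally show ?thesis .
  qed
  have "M * (M * (M * (M * (M * r)))) = (\<Sum>a\<in>B0. \<Sum>b\<in>B1. \<Sum>c\<in>B2. \<Sum>d\<in>B3. \<Sum>e\<in>B4. r)"
    by (simp add: B0 B1 B2 B3 B4 M_def)
  also have "\<dots> \<le> (\<Sum>a\<in>B0. \<Sum>b\<in>B1. \<Sum>c\<in>B2. \<Sum>d\<in>B3. \<Sum>e\<in>B4.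
      g a b + g b c + g c d + g d e + g e a)"
    using B0 B1 B2 B3 B4 by (intro sum_mono lower) auto
  also have "\<dots> = M ^ 3 * ((\<Sum>a\<in>B0. \<Sum>b\<in>B1. g a b) + (\<Sum>b\<in>B1. \<Sum>c\<in>B2. g b c)
    + (\<Sum>c\<in>B2. \<Sum>d\<in>B3. g c d) + (\<Sum>d\<in>B3. \<Sum>e\<in>B4. g d e) + (\<Sum>a\<in>B0. \<Sum>e\<in>B4. g e a))"
    by (simp add: sum.distrib B0 B1 B2 B3 B4 flip: sum_distrib_left M_def)
      (simp add: algebra_simps power3_eq_cube)
  also have "(\<Sum>a\<in>B0. \<Sum>e\<in>B4. g e a) = (\<Sum>e\<in>B4. \<Sum>a\<in>B0. g e a)"
    by (rule sum.swap)
  also have "M ^ 3 * ((\<Sum>a\<in>B0. \<Sum>b\<in>B1. g a b) + (\<Sum>b\<in>B1. \<Sum>c\<in>B2. g b c)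
    + (\<Sum>c\<in>B2. \<Sum>d\<in>B3. g c d) + (\<Sum>d\<in>B3. \<Sum>e\<in>B4. g d e) + (\<Sum>e\<in>B4. \<Sum>a\<in>B0. g e a))
    \<le> M ^ 3 * ?R"
    using B0 B1 B2 B3 B4 fin
    by (intro mult_left_mono add_mono sub) (auto simp: M_def)
  finally have "M ^ 3 * (r * M ^ 2) \<le> M ^ 3 * ?R"
    by (simp add: power2_eq_square power3_eq_cube algebra_simps)
  moreover have "M ^ 3 > 0" using False by (simp add: M_def)
  ultimately show ?thesis by (simp add: M_def)
qed

section \<open>Neighbourhoods and codegrees in a regular graph\<close>

locale regular_adjacency =
  fixes V :: "'a set" and A :: "'a \<Rightarrow> 'a \<Rightarrow> bool" and k :: nat
  assumes fin: "finite V"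
    and sym: "A x y \<Longrightarrow> A y x"
    and irrefl: "\<not> A x x"
    and wf: "A x y \<Longrightarrow> x \<in> V"
    and deg: "x \<in> V \<Longrightarrow> card {y. A x y} = k"
begin

definition N :: "'a \<Rightarrow> 'a set" where "N x = {y. A x y}"

definition codeg :: "'a \<Rightarrow> 'a \<Rightarrow> nat" where "codeg x y = card (N x \<inter> N y)"

text \<open>Counts the triangles at \<open>x\<close> twice, once for each orientation.\<close>
definition tri :: "'a \<Rightarrow> nat" where "tri x = (\<Sum>y\<in>N x. codeg x y)"

text \<open>The candidate part of \<open>a\<close> in a blow-up of the pentagon
  \<open>a b c d e\<close>: such vertices see the five exactly as \<open>a\<close> does. The other
  four parts arise by rotating the arguments.\<close>

definition ptype :: "'a \<Rightarrow> 'a \<Rightarrow> 'a \<Rightarrow> 'a \<Rightarrow> 'a \<Rightarrow> 'a set" where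
  "ptype a b c d e = {v \<in> V. \<not> A v a \<and> A v b \<and> \<not> A v c \<and> \<not> A v d \<and> A v e}"

definition exceptional :: "'a \<Rightarrow> 'a \<Rightarrow> 'a \<Rightarrow> 'a \<Rightarrow> 'a \<Rightarrow> 'a set" where
  "exceptional a b c d e =
     V - (ptype a b c d e \<union> ptype b c d e a \<union> ptype c d e a b \<union> ptype d e a b c \<union> ptype e a b c d)"

lemma N_subset: "N x \<subseteq> V"
  using wf sym by (auto simp: N_def)

lemma finite_N [simp]: "finite (N x)"
  using N_subset fin finite_subset by blast

lemma card_N: "x \<in> V \<Longrightarrow> card (N x) = k"
  using deg by (simp add: N_def)

lemma finite_ptype [simp]: "finite (ptype a b c d e)"
  using fin by (simp add: ptype_def)

lemma ptype_subset: "ptype a b c d e \<subseteq> V"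
  by (auto simp: ptype_def)

lemma ptype_subset_N: "ptype a b c d e \<subseteq> N b" "ptype a b c d e \<subseteq> N e"
  using sym by (auto simp: ptype_def N_def)

lemma codeg_commute: "codeg x y = codeg y x"
  by (simp add: codeg_def Int_commute)

lemma exceptional_rotate: "exceptional b c d e a = exceptional a b c d e"
  by (auto simp: exceptional_def)

lemma sum_adjacent: "x \<in> V \<Longrightarrow> (\<Sum>v\<in>V. of_bool (A v x)) = int k"
proof -
  assume x: "x \<in> V"
  have "V \<inter> {v. A v x} = N x"
    using sym wf by (auto simp: N_def)
  then show ?thesis
    using fin card_N[OF x] by simp
qed

lemma sum_adjacent2: "(\<Sum>v\<in>V. of_bool (A v x \<and> A v y)) = int (codeg x y)"
proof -
  have "V \<inter> {v. A v x \<and> A v y} = N x \<inter> N y"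
    using sym wf by (auto simp: N_def)
  then show ?thesis
    using fin by (simp add: codeg_def)
qed

section \<open>Five vertices in cyclic order and their parts\<close>

text \<open>A vertex adjacent to \<open>t\<close> of the five is a common neighbour of at least
  \<open>t - 2\<close> consecutive pairs, because any three places on a 5-cycle include two
  consecutive ones. Summing over \<open>V\<close> gives the claim for every transversal of the
  parts, pentagon or not.\<close>

lemma five_vertices:
  assumes "a \<in> V" "b \<in> V" "c \<in> V" "d \<in> V" "e \<in> V"
  shows "5 * k \<le> 2 * card V
    + (codeg a b + codeg b c + codeg c d + codeg d e + codeg e a)"
proof -
  have "(\<Sum>v\<in>V. of_bool (A v a) + of_bool (A v b) + of_bool (A v c) + of_bool (A v d)
      + of_bool (A v e) :: int)
    \<le> (\<Sum>v\<in>V. 2 + (of_bool (A v a \<and> A v b) + of_bool (A v b \<and> A v c) + of_bool (A v c \<and> A v d)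
      + of_bool (A v d \<and> A v e) + of_bool (A v e \<and> A v a)))"
    by (intro sum_mono) (auto simp: of_bool_def)
  then show ?thesis
    by (simp only: sum.distrib sum_adjacent assms sum_adjacent2) simp
qed

text \<open>The same pointwise count with an extra 1 for exceptional vertices. Doubling the pair
  terms pays for it: three neighbours among the five may form only one consecutive pair, and then
  \<open>3 + 1\<close> exceeds \<open>2 + 1\<close> but not \<open>2 + 2\<close>.\<close>

lemma card_exceptional:
  assumes "a \<in> V" "b \<in> V" "c \<in> V" "d \<in> V" "e \<in> V"
  shows "card (exceptional a b c d e) + 5 * k \<le> 2 * card V
    + 2 * (codeg a b + codeg b c + codeg c d + codeg d e + codeg e a)"
proof -
  let ?X = "exceptional a b c d e"
  have "(\<Sum>v\<in>V. of_bool (v \<in> ?X)) = int (card ?X)"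
  proof -
    have "V \<inter> {v. v \<in> ?X} = ?X" by (auto simp: exceptional_def)
    then show ?thesis using fin by simp
  qed
  moreover have "(\<Sum>v\<in>V. of_bool (v \<in> ?X) + (of_bool (A v a) + of_bool (A v b) + of_bool (A v c)
      + of_bool (A v d) + of_bool (A v e)) :: int)
    \<le> (\<Sum>v\<in>V. 2 + (of_bool (A v a \<and> A v b) + of_bool (A v b \<and> A v c) + of_bool (A v c \<and> A v d)
      + of_bool (A v d \<and> A v e) + of_bool (A v e \<and> A v a))
      + (of_bool (A v a \<and> A v b) + of_bool (A v b \<and> A v c) + of_bool (A v c \<and> A v d)
      + of_bool (A v d \<and> A v e) + of_bool (A v e \<and> A v a)))"
    by (intro sum_mono) (auto simp: of_bool_def exceptional_def ptype_def)
  ultimately have "int (card ?X) + 5 * int k \<le> 2 * int (card V)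
    + 2 * (int (codeg a b) + int (codeg b c) + int (codeg c d) + int (codeg d e) + int (codeg e a))"
    by (simp only: sum.distrib sum_adjacent assms sum_adjacent2) simp
  then show ?thesis
    by (simp flip: of_nat_le_iff[where ?'a = int])
qed

text \<open>The parts of \<open>a\<close> and \<open>c\<close>, the two cyclic neighbours of
  \<open>b\<close>, are disjoint subsets of \<open>N b\<close>.\<close>

lemma card_ptype_add_le:
  assumes "b \<in> V"
  shows "card (ptype a b c d e) + card (ptype c d e a b) \<le> k"
proof -
  have "card (ptype a b c d e) + card (ptype c d e a b) = card (ptype a b c d e \<union> ptype c d e a b)"
    by (rule card_Un_disjoint[symmetric, OF finite_ptype finite_ptype]) (auto simp: ptype_def)
  also have "\<dots> \<le> card (N b)"
    using ptype_subset_N by (intro card_mono) auto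
  finally show ?thesis using card_N assms by simp
qed

lemma card_V_le:
  "card V \<le> card (exceptional a b c d e) + card (ptype a b c d e) + card (ptype b c d e a)
    + card (ptype c d e a b) + card (ptype d e a b c) + card (ptype e a b c d)"
proof -
  have "V \<subseteq> exceptional a b c d e \<union> ptype a b c d e \<union> ptype b c d e a
    \<union> ptype c d e a b \<union> ptype d e a b c \<union> ptype e a b c d"
    by (auto simp: exceptional_def)
  then have "card V \<le> card (exceptional a b c d e \<union> ptype a b c d e \<union> ptype b c d e a
    \<union> ptype c d e a b \<union> ptype d e a b c \<union> ptype e a b c d)"
    using fin by (intro card_mono) (auto simp: exceptional_def)
  also have "\<dots> \<le> card (exceptional a b c d e) + card (ptype a b c d e) + card (ptype b c d e a)
    + card (ptype c d e a b) + card (ptype d e a b c) + card (ptype e a b c d)"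
    by (intro order_trans[OF card_Un_le] add_mono order_refl)
  finally show ?thesis .
qed

text \<open>The other four parts pair up: those of \<open>b\<close> and \<open>d\<close> lie in
  \<open>N c\<close>, those of \<open>c\<close> and \<open>e\<close> in \<open>N d\<close>, so
  together they have at most \<open>2 * k\<close> elements.\<close>

lemma card_ptype_ge:
  assumes "a \<in> V" "b \<in> V" "c \<in> V" "d \<in> V" "e \<in> V"
  shows "card V \<le> card (exceptional a b c d e) + card (ptype a b c d e) + 2 * k"
  using card_V_le[of a b c d e] card_ptype_add_le[of c b d e a] card_ptype_add_le[of d c e a b] assms
  by linarith

lemma card_ptype_le: "b \<in> V \<Longrightarrow> card (ptype a b c d e) \<le> k"
  using card_ptype_add_le[of b a c d e] by linarith

text \<open>The parts of \<open>b\<close> and \<open>e\<close> both lie in \<open>N a\<close>, so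
  they have at most \<open>k\<close> elements in total. A vertex \<open>u\<close> in the part of
  \<open>a\<close> has degree \<open>k\<close>, so each non-neighbour in the part of
  \<open>b\<close> forces a neighbour outside these two parts. Such neighbours are exceptional or
  form triangles with \<open>u\<close> and \<open>b\<close> or \<open>e\<close>.\<close>

lemma missing_pairs:
  assumes "a \<in> V" "b \<in> V" "e \<in> V"
  shows "(\<Sum>u\<in>ptype a b c d e. card (ptype b c d e a - N u))
    \<le> k * card (exceptional a b c d e) + tri b + tri e"
proof -
  let ?X = "exceptional a b c d e"
  let ?W0 = "ptype a b c d e" and ?W1 = "ptype b c d e a" and ?W2 = "ptype c d e a b"
    and ?W3 = "ptype d e a b c" and ?W4 = "ptype e a b c d"
  have one: "card (?W1 - N u) \<le> card ?X + (codeg b u + codeg e u)" if u: "u \<in> ?W0" for u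
  proof -
    have uV: "u \<in> V" using u ptype_subset by blast
    \<comment> \<open>\<open>?W0\<close> and \<open>?W2\<close> lie in \<open>N b\<close> and
      \<open>?W3\<close> lies in \<open>N e\<close>, so neighbours of \<open>u\<close> there are
      counted by the two codegrees.\<close>
    have "N u \<subseteq> (?W1 \<inter> N u) \<union> ?W4 \<union> ?X \<union> (N b \<inter> N u) \<union> (N e \<inter> N u)"
    proof
      fix v assume v: "v \<in> N u"
      then have "v \<in> ?X \<union> ?W0 \<union> ?W1 \<union> ?W2 \<union> ?W3 \<union> ?W4"
        using N_subset by (auto simp: exceptional_def)
      then show "v \<in> (?W1 \<inter> N u) \<union> ?W4 \<union> ?X \<union> (N b \<inter> N u) \<union> (N e \<inter> N u)"
        using v ptype_subset_N by blast
    qed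
    then have "card (N u) \<le> card ((?W1 \<inter> N u) \<union> ?W4 \<union> ?X \<union> (N b \<inter> N u) \<union> (N e \<inter> N u))"
      using fin by (intro card_mono) (auto simp: exceptional_def)
    also have "\<dots> \<le> card (?W1 \<inter> N u) + card ?W4 + card ?X + card (N b \<inter> N u) + card (N e \<inter> N u)"
      by (intro order_trans[OF card_Un_le] add_mono order_refl)
    finally have "k \<le> card (?W1 \<inter> N u) + card ?W4 + card ?X + codeg b u + codeg e u"
      using card_N[OF uV] by (simp add: codeg_def)
    moreover have "card ?W1 = card (?W1 \<inter> N u) + card (?W1 - N u)"
      by (subst card_Un_disjoint[symmetric]) (auto simp: Int_Diff_Un)
    moreover have "card ?W4 + card ?W1 \<le> k"
      using card_ptype_add_le[of a e b c d] assms by simp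
    ultimately show ?thesis by linarith
  qed
  have "(\<Sum>u\<in>?W0. card (?W1 - N u)) \<le> (\<Sum>u\<in>?W0. card ?X + (codeg b u + codeg e u))"
    by (intro sum_mono one)
  also have "\<dots> = card ?W0 * card ?X + ((\<Sum>u\<in>?W0. codeg b u) + (\<Sum>u\<in>?W0. codeg e u))"
    by (simp add: sum.distrib)
  also have "\<dots> \<le> k * card ?X + (tri b + tri e)"
    unfolding tri_def using assms ptype_subset_N
    by (intro add_mono mult_right_mono card_ptype_le sum_mono2) auto
  finally show ?thesis by simp
qed

section \<open>Weights on pairs of vertices\<close>

text \<open>The value 0 on non-adjacent pairs lets sums range over arbitrary vertex sets while
  counting only triangles.\<close>

definition wcodeg :: "'a \<Rightarrow> 'a \<Rightarrow> nat" where
  "wcodeg x y = (if A x y then codeg x y else 0)"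

text \<open>Non-adjacent pairs receive weight 2, so that when \<open>5 k - 2 n \<ge> 2\<close> the five consecutive
  pairs of any cyclic sequence of vertices have total weight at least 2, pentagon or not.\<close>
definition wt :: "'a \<Rightarrow> 'a \<Rightarrow> nat" where
  "wt x y = (if A x y then codeg x y else 2)"

lemma tri_eq_wcodeg: "tri x = (\<Sum>y\<in>V. wcodeg x y)"
proof -
  have "(\<Sum>y\<in>V. wcodeg x y) = (\<Sum>y\<in>N x. wcodeg x y)"
    using N_subset fin by (intro sum.mono_neutral_right) (auto simp: wcodeg_def N_def)
  then show ?thesis
    by (simp add: tri_def wcodeg_def N_def)
qed

lemma wcodeg_commute: "wcodeg x y = wcodeg y x"
  using sym by (auto simp: wcodeg_def codeg_commute)

lemma sum_wt:
  "(\<Sum>x\<in>P. \<Sum>y\<in>Q. wt x y) = (\<Sum>x\<in>P. \<Sum>y\<in>Q. wcodeg x y) + 2 * (\<Sum>x\<in>P. card (Q - N x))"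
  if "finite Q"
proof -
  have "(\<Sum>y\<in>Q. wt x y) = (\<Sum>y\<in>Q. wcodeg x y) + 2 * card (Q - N x)" for x
  proof -
    have "(\<Sum>y\<in>Q. wt x y) = (\<Sum>y\<in>Q. wcodeg x y + 2 * of_bool (y \<notin> N x))"
      by (intro sum.cong) (auto simp: wt_def wcodeg_def N_def)
    also have "\<dots> = (\<Sum>y\<in>Q. wcodeg x y) + 2 * (\<Sum>y\<in>Q. of_bool (y \<notin> N x))"
      by (simp only: sum.distrib sum_distrib_left)
    also have "(\<Sum>y\<in>Q. of_bool (y \<notin> N x)) = card (Q - N x)"
      using that by (simp add: Diff_eq Collect_neg_eq)
    finally show ?thesis .
  qed
  then show ?thesis by (simp add: sum.distrib sum_distrib_left)
qed

text \<open>By symmetry each of the five sums can be charged to either of its two sets. A vertex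
  \<open>x\<close> of one set is then charged for two disjoint sets of partners, at most
  \<open>tri x\<close> in total, so charging both ways produces the factor 2.\<close>

lemma sum_wcodeg_cyclic:
  fixes W0 W1 W2 W3 W4 :: "'a set"
  assumes sub: "W0 \<subseteq> V" "W1 \<subseteq> V" "W2 \<subseteq> V" "W3 \<subseteq> V" "W4 \<subseteq> V"
    and disj: "W0 \<inter> W1 = {}" "W0 \<inter> W2 = {}" "W0 \<inter> W3 = {}" "W0 \<inter> W4 = {}" "W1 \<inter> W2 = {}"
      "W1 \<inter> W3 = {}" "W1 \<inter> W4 = {}" "W2 \<inter> W3 = {}" "W2 \<inter> W4 = {}" "W3 \<inter> W4 = {}"
  defines "S \<equiv> \<lambda>P Q. (\<Sum>x\<in>P. \<Sum>y\<in>Q. wcodeg x y)"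
  shows "2 * (S W0 W1 + S W1 W2 + S W2 W3 + S W3 W4 + S W4 W0) \<le> sum tri V"
proof -
  have fins: "finite W0" "finite W1" "finite W2" "finite W3" "finite W4"
    using sub fin finite_subset by blast+
  have S_swap: "S P Q = S Q P" for P Q
    unfolding S_def by (subst sum.swap) (simp add: wcodeg_commute)
  have two: "S P Q + S P R \<le> sum tri P"
    if "Q \<subseteq> V" "R \<subseteq> V" "Q \<inter> R = {}" for P Q R
  proof -
    have "(\<Sum>y\<in>Q. wcodeg x y) + (\<Sum>y\<in>R. wcodeg x y) \<le> tri x" for x
    proof -
      have "(\<Sum>y\<in>Q. wcodeg x y) + (\<Sum>y\<in>R. wcodeg x y) = (\<Sum>y\<in>Q \<union> R. wcodeg x y)"
        using that fin by (intro sum.union_disjoint[symmetric]) (auto intro: finite_subset)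
      also have "\<dots> \<le> tri x"
        unfolding tri_eq_wcodeg using that fin by (intro sum_mono2) auto
      finally show ?thesis .
    qed
    then show ?thesis
      unfolding S_def sum.distrib[symmetric] by (rule sum_mono)
  qed
  have "sum tri W0 + sum tri W1 + sum tri W2 + sum tri W3 + sum tri W4
    = (\<Sum>x\<in>W0 \<union> W1 \<union> W2 \<union> W3 \<union> W4. tri x)"
    using fins disj by (subst sum.union_disjoint; auto)+
  also have "\<dots> \<le> sum tri V"
    using fin sub by (intro sum_mono2) auto
  finally have "sum tri W0 + sum tri W1 + sum tri W2 + sum tri W3
    + sum tri W4 \<le> sum tri V" .
  moreover have "S W0 W1 + S W4 W0 \<le> sum tri W0"
    using two[of W1 W4 W0] sub disj S_swap[of W0 W4] by simp
  moreover have "S W1 W2 + S W0 W1 \<le> sum tri W1"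
    using two[of W2 W0 W1] sub disj S_swap[of W1 W0] by (simp add: Int_commute)
  moreover have "S W2 W3 + S W1 W2 \<le> sum tri W2"
    using two[of W3 W1 W2] sub disj S_swap[of W2 W1] by (simp add: Int_commute)
  moreover have "S W3 W4 + S W2 W3 \<le> sum tri W3"
    using two[of W4 W2 W3] sub disj S_swap[of W3 W2] by (simp add: Int_commute)
  moreover have "S W4 W0 + S W3 W4 \<le> sum tri W4"
    using two[of W0 W3 W4] sub disj S_swap[of W4 W3] by simp
  ultimately show ?thesis by (simp only: distrib_left)
qed

section \<open>Excluding light pentagons and two-colouring the light graph\<close>

text \<open>Averaging gives the total weight a lower bound of about \<open>k ^ 2 / 2\<close>, while
  the triangle bound allows about \<open>3 / 8 * k ^ 2\<close>. All errors are of order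
  \<open>k * s\<close>, hence negligible for \<open>s\<close> at least 20000.\<close>

lemma no_light_pentagon:
  fixes s :: real
  defines "s \<equiv> sqrt (real k)"
  assumes V: "a \<in> V" "b \<in> V" "c \<in> V" "d \<in> V" "e \<in> V"
    and light: "codeg a b \<le> 10 * s" "codeg b c \<le> 10 * s" "codeg c d \<le> 10 * s"
      "codeg d e \<le> 10 * s" "codeg e a \<le> 10 * s"
    and few: "tri a \<le> k * s / 2" "tri b \<le> k * s / 2" "tri c \<le> k * s / 2"
      "tri d \<le> k * s / 2" "tri e \<le> k * s / 2"
    and dense: "2 * card V + 2 \<le> 5 * k"
    and total: "real (sum tri V) \<le> 3 / 2 * k * (3 * real k - real (card V) - 1)"
    and large: "s \<ge> 20000"
  shows False
proof -
  define n where "n = real (card V)"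
  define X where "X = real (card (exceptional a b c d e))"
  define W0 where "W0 = ptype a b c d e"
  define W1 where "W1 = ptype b c d e a"
  define W2 where "W2 = ptype c d e a b"
  define W3 where "W3 = ptype d e a b c"
  define W4 where "W4 = ptype e a b c d"
  note W_defs = W0_def W1_def W2_def W3_def W4_def
  define S where "S = (\<lambda>P Q. real (\<Sum>x\<in>P. \<Sum>y\<in>Q. wcodeg x y))"
  define G where "G = (\<lambda>P Q. \<Sum>x\<in>P. \<Sum>y\<in>Q. real (wt x y))"
  define m where "m = nat \<lceil>real k / 2 - 100 * s\<rceil>"
  have k: "real k = s ^ 2" by (simp add: s_def)
  have X: "X + 5 * k \<le> 2 * n + 100 * s"
  proof -
    have "X + 5 * k \<le> 2 * n + 2 * (real (codeg a b) + real (codeg b c) + real (codeg c d)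
      + real (codeg d e) + real (codeg e a))"
      using of_nat_mono[OF card_exceptional[OF V], where ?'a = real] by (simp add: X_def n_def)
    then show ?thesis using light by (simp add: algebra_simps)
  qed
  have "2 * n + 2 \<le> 5 * k" using dense unfolding n_def by linarith
  have rot: "exceptional b c d e a = exceptional a b c d e" "exceptional c d e a b = exceptional a b c d e"
    "exceptional d e a b c = exceptional a b c d e" "exceptional e a b c d = exceptional a b c d e"
    by (simp_all add: exceptional_rotate)
  have X_nonneg: "X \<ge> 0" by (simp add: X_def)
  have size: "m \<le> card W" if "card V \<le> card (exceptional a b c d e) + card W + 2 * k" for W :: "'a set"
  proof -
    have "n \<le> X + card W + 2 * k"
      using that unfolding n_def X_def by linarith
    then have "real k / 2 - 100 * s \<le> card W"
      using X X_nonneg \<open>2 * n + 2 \<le> 5 * k\<close> by linarith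
    then show ?thesis unfolding m_def by linarith
  qed
  have W: "m \<le> card W0" "m \<le> card W1" "m \<le> card W2" "m \<le> card W3" "m \<le> card W4"
    unfolding W_defs using card_ptype_ge[of a b c d e] card_ptype_ge[of b c d e a]
      card_ptype_ge[of c d e a b] card_ptype_ge[of d e a b c] card_ptype_ge[of e a b c d] V
    by (intro size; simp add: rot)+
  \<comment> \<open>At most \<open>k * X\<close> missing pairs come from exceptional vertices, where
    \<open>X\<close> is at most \<open>100 * s\<close>, and at most \<open>k * s\<close> from the
    two \<open>tri\<close> terms; weight 2 on each gives \<open>2 * 101 = 202\<close>.\<close>
  have G_le: "G P Q \<le> S P Q + 202 * (k * s)"
    if "(\<Sum>u\<in>P. card (Q - N u)) \<le> k * card (exceptional a b c d e) + tri x + tri y"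
      "tri x \<le> k * s / 2" "tri y \<le> k * s / 2" "finite Q" for P Q x y
  proof -
    have "G P Q = S P Q + 2 * real (\<Sum>u\<in>P. card (Q - N u))"
      using arg_cong[OF sum_wt[OF that(4), of P], of real] by (simp add: G_def S_def)
    moreover have "real (\<Sum>u\<in>P. card (Q - N u)) \<le> k * X + tri x + tri y"
      using that(1) unfolding X_def by (metis of_nat_add of_nat_le_iff of_nat_mult)
    moreover have "k * X \<le> k * (100 * s)"
      using X \<open>2 * n + 2 \<le> 5 * k\<close> by (intro mult_left_mono) auto
    ultimately show ?thesis using that(2,3) by linarith
  qed
  have G: "G W0 W1 \<le> S W0 W1 + 202 * (k * s)" "G W1 W2 \<le> S W1 W2 + 202 * (k * s)"
    "G W2 W3 \<le> S W2 W3 + 202 * (k * s)" "G W3 W4 \<le> S W3 W4 + 202 * (k * s)"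
    "G W4 W0 \<le> S W4 W0 + 202 * (k * s)"
    using G_le[OF missing_pairs[of a b e c d]] G_le[OF missing_pairs[of b c a d e, unfolded rot]]
      G_le[OF missing_pairs[of c d b e a, unfolded rot]]
      G_le[OF missing_pairs[of d e c a b, unfolded rot]]
      G_le[OF missing_pairs[of e a d b c, unfolded rot]] V few
    unfolding W_defs by simp_all
  have "2 * ((\<Sum>x\<in>W0. \<Sum>y\<in>W1. wcodeg x y) + (\<Sum>x\<in>W1. \<Sum>y\<in>W2. wcodeg x y)
    + (\<Sum>x\<in>W2. \<Sum>y\<in>W3. wcodeg x y) + (\<Sum>x\<in>W3. \<Sum>y\<in>W4. wcodeg x y)
    + (\<Sum>x\<in>W4. \<Sum>y\<in>W0. wcodeg x y)) \<le> sum tri V"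
    unfolding W_defs by (rule sum_wcodeg_cyclic) (auto simp: ptype_def)
  from of_nat_mono[OF this, where ?'a = real]
  have "2 * (S W0 W1 + S W1 W2 + S W2 W3 + S W3 W4 + S W4 W0) \<le> real (sum tri V)"
    unfolding S_def by (simp only: of_nat_add of_nat_mult of_nat_numeral)
  also have "\<dots> \<le> 3 / 2 * k * (3 * real k - n - 1)"
    using total unfolding n_def .
  \<comment> \<open>Since \<open>X\<close> is nonnegative, its upper bound forces \<open>n\<close>
    to be at least \<open>5 / 2 * k - 50 * s\<close>, which sharpens the triangle bound.\<close>
  also have "\<dots> \<le> 3 / 2 * k * (real k / 2 + 50 * s)"
    using X X_nonneg by (intro mult_left_mono) auto
  also have "\<dots> = 2 * (3 / 8 * real k ^ 2 + 75 / 2 * (k * s))"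
    by (simp add: field_simps power2_eq_square)
  finally have S: "S W0 W1 + S W1 W2 + S W2 W3 + S W3 W4 + S W4 W0
      \<le> 3 / 8 * real k ^ 2 + 75 / 2 * (k * s)"
    by (rule mult_left_le_imp_le) simp
  have "2 * real m ^ 2 \<le> G W0 W1 + G W1 W2 + G W2 W3 + G W3 W4 + G W4 W0"
    unfolding G_def
  proof (rule cyclic_product_average)
    fix v w x y z
    assume "v \<in> W0" "w \<in> W1" "x \<in> W2" "y \<in> W3" "z \<in> W4"
    then have "v \<in> V" "w \<in> V" "x \<in> V" "y \<in> V" "z \<in> V"
      unfolding W_defs by (auto dest: subsetD[OF ptype_subset])
    from five_vertices[OF this] dense
    have "2 \<le> wt v w + wt w x + wt x y + wt y z + wt z v"
      by (auto simp: wt_def)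
    then show "2 \<le> real (wt v w) + real (wt w x) + real (wt x y) + real (wt y z) + real (wt z v)"
      by linarith
  qed (use W in \<open>auto simp: W_defs\<close>)
  \<comment> \<open>The error is \<open>75 / 2\<close> from the triangle bound plus five times 202
    from the missing pairs.\<close>
  then have "2 * real m ^ 2 \<le> 3 / 8 * real k ^ 2 + 2095 / 2 * (k * s)"
    using G S by linarith
  moreover have "(real k / 2 - 100 * s) ^ 2 \<le> real m ^ 2"
  proof (intro power_mono)
    show "real k / 2 - 100 * s \<le> real m" unfolding m_def by linarith
    have "100 * s \<le> s / 2 * s" using large by (intro mult_right_mono) auto
    then show "0 \<le> real k / 2 - 100 * s" by (simp add: k power2_eq_square)
  qed
  moreover have "(real k / 2 - 100 * s) ^ 2 = real k ^ 2 / 4 - 100 * (k * s) + 10000 * s ^ 2"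
    by (simp add: power2_eq_square algebra_simps)
  moreover have "0 \<le> 10000 * s ^ 2" by simp
  ultimately have "real k ^ 2 \<le> 9980 * (k * s)" by linarith
  moreover have "s ^ 3 * 20000 \<le> s ^ 3 * s" using large by (intro mult_left_mono) auto
  moreover have "s ^ 3 > 0" using large by simp
  ultimately show False
    by (simp add: k power2_eq_square power3_eq_cube algebra_simps)
qed

text \<open>The bipartition is read off a single remaining edge \<open>uv\<close>: one side consists of the vertices
  having a common neighbour with \<open>u\<close>.\<close>
lemma light_part_bipartite:
  fixes B :: "'a set" and s :: real
  defines "s \<equiv> sqrt (real k)"
  defines "B \<equiv> {v \<in> V. tri v > k * s / 2}"
  defines "L \<equiv> \<lambda>x y. A x y \<and> codeg x y \<le> 10 * s \<and> x \<notin> B \<and> y \<notin> B"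
  assumes dense: "2 * card V + 2 \<le> 5 * k" and sparse: "2 * k \<le> card V"
    and total: "real (sum tri V) \<le> 3 / 2 * k * (3 * real k - real (card V) - 1)"
    and large: "s \<ge> 20000"
  shows "card B \<le> 3 * s"
    and "card {(x, y). A x y \<and> codeg x y > 10 * s} \<le> 3 / 20 * k * s"
    and "\<exists>P. \<forall>x y. L x y \<longrightarrow> (x \<in> P) \<noteq> (y \<in> P)"
proof -
  have k: "real k = s * s" by (simp add: s_def)
  have s: "s > 0" using large by linarith
  have kpos: "real k > 0" using k s by simp
  \<comment> \<open>As \<open>card V\<close> is at least \<open>2 * k\<close>, the last factor is at
    most \<open>k\<close>.\<close>
  have "3 / 2 * k * (3 * real k - real (card V) - 1) \<le> 3 / 2 * k * k"
    using sparse by (intro mult_left_mono) auto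
  with total have T: "real (sum tri V) \<le> 3 / 2 * k * k" by linarith
  have finB: "finite B" using fin by (simp add: B_def)
  have "card B * (k * s / 2) = (\<Sum>x\<in>B. k * s / 2)" by simp
  also have "\<dots> \<le> (\<Sum>x\<in>B. real (tri x))"
    by (intro sum_mono) (auto simp: B_def)
  also have "\<dots> \<le> (\<Sum>x\<in>V. real (tri x))"
    using fin by (intro sum_mono2) (auto simp: B_def)
  also have "\<dots> \<le> (3 * s) * (k * s / 2)" using T k by simp
  finally show card_B: "card B \<le> 3 * s"
    using kpos s by (simp add: mult_le_cancel_right)
  have heavy: "card {y. A x y \<and> codeg x y > 10 * s} * (10 * s) \<le> tri x" for x
  proof -
    have "card {y. A x y \<and> codeg x y > 10 * s} * (10 * s)
        = (\<Sum>y | A x y \<and> codeg x y > 10 * s. 10 * s)" by simp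
    also have "\<dots> \<le> (\<Sum>y | A x y \<and> codeg x y > 10 * s. real (codeg x y))"
      by (intro sum_mono) auto
    also have "\<dots> \<le> (\<Sum>y\<in>N x. real (codeg x y))"
      by (intro sum_mono2 finite_N) (auto simp: N_def)
    finally show ?thesis by (simp add: tri_def)
  qed
  show "card {(x, y). A x y \<and> codeg x y > 10 * s} \<le> 3 / 20 * k * s"
  proof -
    have "{(x, y). A x y \<and> codeg x y > 10 * s} = (SIGMA x:V. {y. A x y \<and> codeg x y > 10 * s})"
      using wf by auto
    then have "card {(x, y). A x y \<and> codeg x y > 10 * s}
        = (\<Sum>x\<in>V. card {y. A x y \<and> codeg x y > 10 * s})"
      using fin finite_N by (simp add: N_def)
    then have "card {(x, y). A x y \<and> codeg x y > 10 * s} * (10 * s)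
        = (\<Sum>x\<in>V. card {y. A x y \<and> codeg x y > 10 * s} * (10 * s))"
      by (simp add: sum_distrib_right)
    also have "\<dots> \<le> (\<Sum>x\<in>V. real (tri x))"
      by (intro sum_mono heavy)
    also have "\<dots> \<le> (3 / 20 * k * s) * (10 * s)" using T k by simp
    finally show ?thesis using s by (simp add: mult_le_cancel_right mult.commute mult.left_commute)
  qed
  have L_sym: "L x y \<Longrightarrow> L y x" for x y
    using sym by (auto simp: L_def codeg_commute)
  have L_V: "L x y \<Longrightarrow> x \<in> V \<and> x \<notin> B" for x y
    using wf by (auto simp: L_def)
  have L_few: "L x y \<Longrightarrow> tri x \<le> k * s / 2" for x y
    using wf by (force simp: L_def B_def)
  have finL: "finite {y. L x y}" for x
    by (rule finite_subset[OF _ finite_N[of x]]) (auto simp: L_def N_def)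
  \<comment> \<open>At most \<open>k / 20\<close> edges at \<open>x\<close> are heavy, as each
    contributes more than \<open>10 * s\<close> to \<open>tri x\<close>, and at most
    \<open>3 * s\<close>, again below \<open>k / 20\<close>, lead into \<open>B\<close>.\<close>
  have L_deg: "card {y. L x y} \<ge> 9 / 10 * k" if x: "x \<in> V" "x \<notin> B" for x
  proof -
    have "N x \<subseteq> {y. L x y} \<union> {y. A x y \<and> codeg x y > 10 * s} \<union> B"
      using x by (auto simp: L_def N_def)
    then have "card (N x) \<le> card ({y. L x y} \<union> {y. A x y \<and> codeg x y > 10 * s} \<union> B)"
      using finL finB finite_N[of x] by (intro card_mono) (auto simp: N_def)
    also have "\<dots> \<le> card {y. L x y} + card {y. A x y \<and> codeg x y > 10 * s} + card B"
      by (intro order_trans[OF card_Un_le] add_mono order_refl)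
    finally have "k \<le> card {y. L x y} + card {y. A x y \<and> codeg x y > 10 * s} + card B"
      using card_N x by simp
    moreover have "card {y. A x y \<and> codeg x y > 10 * s} * (10 * s) \<le> (k / 20) * (10 * s)"
      using heavy[of x] x by (simp add: B_def algebra_simps)
    then have "card {y. A x y \<and> codeg x y > 10 * s} \<le> real k / 20"
      using s by (simp add: mult_le_cancel_right)
    moreover have "3 * s \<le> s / 20 * s"
      using large by (intro mult_right_mono) auto
    ultimately show ?thesis using card_B k by linarith
  qed
  \<comment> \<open>With small codegrees the three neighbourhoods are almost disjoint and cover
    nearly \<open>3 * k\<close> vertices, more than the \<open>5 / 2 * k\<close> available.\<close>
  have no_triangle: False if "L x y" "L y z" "L z x" for x y z
  proof -
    have V: "x \<in> V" "y \<in> V" "z \<in> V" using that L_V by auto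
    have "card (N x \<union> N y) + codeg x y = 2 * k"
      using card_Un_Int[of "N x" "N y"] V by (simp add: codeg_def card_N)
    moreover have "card (N x \<union> N y \<union> N z) + card ((N x \<union> N y) \<inter> N z) = card (N x \<union> N y) + k"
      using card_Un_Int[of "N x \<union> N y" "N z"] V by (simp add: card_N)
    moreover have "card ((N x \<union> N y) \<inter> N z) \<le> codeg z x + codeg y z"
      using card_Un_le[of "N x \<inter> N z" "N y \<inter> N z"]
      by (simp add: codeg_def Int_Un_distrib2 Int_commute[of "N z" "N x"])
    moreover have "card (N x \<union> N y \<union> N z) \<le> card V"
      using N_subset fin by (intro card_mono) auto
    ultimately have "3 * k \<le> card V + (codeg x y + codeg y z + codeg z x)" by linarith
    moreover have "codeg x y \<le> 10 * s" "codeg y z \<le> 10 * s" "codeg z x \<le> 10 * s"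
      using that by (auto simp: L_def)
    ultimately have "k \<le> 60 * s" using dense by linarith
    moreover have "20000 * s \<le> s * s" using large s by (intro mult_right_mono) auto
    ultimately show False using k s by linarith
  qed
  have no_pentagon: False if "L a b" "L b c" "L c d" "L d e" "L e a" for a b c d e
  proof (rule no_light_pentagon[of a b c d e, folded s_def])
    show "a \<in> V" "b \<in> V" "c \<in> V" "d \<in> V" "e \<in> V"
      using that L_V by blast+
    show "tri a \<le> k * s / 2" "tri b \<le> k * s / 2" "tri c \<le> k * s / 2"
      "tri d \<le> k * s / 2" "tri e \<le> k * s / 2"
      using that L_few by blast+
  qed (use that dense total large in \<open>simp_all add: L_def\<close>)
  \<comment> \<open>Otherwise the light neighbourhoods of \<open>x\<close>, \<open>u\<close> and
    \<open>v\<close> would be pairwise disjoint, requiring \<open>27 / 10 * k\<close>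
    vertices.\<close>
  have common: "\<exists>w. L x w \<and> L w v"
    if "L u v" "x \<in> V" "x \<notin> B" "\<not> (\<exists>w. L x w \<and> L w u)" for x u v
  proof (rule ccontr)
    assume none: "\<not> (\<exists>w. L x w \<and> L w v)"
    have disj: "{w. L x w} \<inter> {w. L u w} = {}" "{w. L x w} \<inter> {w. L v w} = {}"
      "{w. L u w} \<inter> {w. L v w} = {}"
      using that none L_sym no_triangle by blast+
    have "card ({w. L x w} \<union> {w. L u w} \<union> {w. L v w}) \<le> card V"
      using fin L_V L_sym by (intro card_mono) blast+
    moreover have "card ({w. L x w} \<union> {w. L u w} \<union> {w. L v w})
      = card {w. L x w} + card {w. L u w} + card {w. L v w}"
      using disj finL by (subst card_Un_disjoint; auto)+
    moreover have "card {w. L u w} \<ge> 9 / 10 * k" "card {w. L v w} \<ge> 9 / 10 * k"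
      "card {w. L x w} \<ge> 9 / 10 * k"
      using that L_V L_sym by (blast intro: L_deg)+
    ultimately show False using dense kpos by linarith
  qed
  show "\<exists>P. \<forall>x y. L x y \<longrightarrow> (x \<in> P) \<noteq> (y \<in> P)"
  proof (cases "\<exists>u v. L u v")
    case False
    then show ?thesis by blast
  next
    case True
    then obtain u v where uv: "L u v" by blast
    have "(\<exists>w. L x w \<and> L w u) \<noteq> (\<exists>w. L y w \<and> L w u)" if xy: "L x y" for x y
    proof
      assume eq: "(\<exists>w. L x w \<and> L w u) = (\<exists>w. L y w \<and> L w u)"
      \<comment> \<open>Both endpoints share a light neighbour with the same \<open>t\<close>,
        either \<open>u\<close> or \<open>v\<close>. This closes a walk of length five;
        \<open>no_pentagon\<close> also covers walks with repeated vertices.\<close>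
      have "\<exists>t. (\<exists>w. L x w \<and> L w t) \<and> (\<exists>w. L y w \<and> L w t)"
      proof (cases "\<exists>w. L x w \<and> L w u")
        case True
        then show ?thesis using eq by blast
      next
        case False
        then show ?thesis
          using eq common[OF uv] L_V[OF xy] L_V[OF L_sym[OF xy]] by blast
      qed
      then obtain t w w' where "L x w" "L w t" "L y w'" "L w' t" by blast
      then show False
        using no_pentagon[of x w t w' y] L_sym xy by blast
    qed
    then show ?thesis
      by (intro exI[of _ "{x. \<exists>w. L x w \<and> L w u}"]) simp
  qed
qed

end

section \<open>From edge sets to the adjacency relation, and the deleted edges\<close>

text \<open>Each triangle has six orderings; summing \<open>tri\<close> over all vertices counts
  exactly the ordered triples.\<close>

lemma card_ordered_triangles_le:
  assumes fin: "finite V" and irrefl: "\<And>x. {x} \<notin> E" and wf: "\<And>x y. {x, y} \<in> E \<Longrightarrow> x \<in> V"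
  shows "card {(x, y, z). {x, y} \<in> E \<and> {x, z} \<in> E \<and> {y, z} \<in> E} \<le> 6 * card (triangles V E)"
    (is "card ?O \<le> _")
proof -
  let ?orderings = "\<lambda>T. {(x, y, z). T = {x, y, z} \<and> x \<noteq> y \<and> x \<noteq> z \<and> y \<noteq> z}"
  have finT: "finite (triangles V E)"
    using fin by (auto simp: triangles_def intro: finite_subset[of _ "Pow V"])
  have orderings: "finite (?orderings T) \<and> card (?orderings T) \<le> 6" if T3: "card T = 3" for T :: "'a set"
  proof -
    obtain a b c where T: "T = {a, b, c}"
      using T3 unfolding card_3_iff by blast
    let ?L = "[(a, b, c), (a, c, b), (b, a, c), (b, c, a), (c, a, b), (c, b, a)]"
    have sub: "?orderings T \<subseteq> set ?L"
    proof clarify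
      fix x y z
      assume eq: "T = {x, y, z}" and ne: "x \<noteq> y" "x \<noteq> z" "y \<noteq> z"
      have "x \<in> {a, b, c}" "y \<in> {a, b, c}" "z \<in> {a, b, c}"
        unfolding T[symmetric] eq by simp_all
      then show "(x, y, z) \<in> set ?L" using ne by auto
    qed
    then have "card (?orderings T) \<le> card (set ?L)"
      by (intro card_mono) auto
    also have "\<dots> \<le> length ?L" by (rule card_length)
    finally show ?thesis
      using finite_subset[OF sub] by simp
  qed
  have "?O \<subseteq> (\<Union>T\<in>triangles V E. ?orderings T)"
  proof clarsimp
    fix x y z
    assume e: "{x, y} \<in> E" "{x, z} \<in> E" "{y, z} \<in> E"
    then have "x \<noteq> y" "x \<noteq> z" "y \<noteq> z" using irrefl by auto
    then show "{x, y, z} \<in> triangles V E \<and> x \<noteq> y \<and> x \<noteq> z \<and> y \<noteq> z"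
      using e wf[of x y] wf[of y z] wf[of z x]
      by (auto simp: triangles_def insert_commute)
  qed
  then have "card ?O \<le> card (\<Union>T\<in>triangles V E. ?orderings T)"
    using finT orderings by (intro card_mono finite_UN_I) (auto simp: triangles_def)
  also have "\<dots> \<le> (\<Sum>T\<in>triangles V E. card (?orderings T))"
    by (rule card_UN_le[OF finT])
  also have "\<dots> \<le> (\<Sum>T\<in>triangles V E. 6)"
    using orderings by (intro sum_mono) (auto simp: triangles_def)
  finally show ?thesis by simp
qed

lemma card_neighbours_eq_degree:
  assumes "simple_graph V E"
  shows "card {y. {x, y} \<in> E} = vertex_degree E x"
proof -
  have "bij_betw (\<lambda>y. {x, y}) {y. {x, y} \<in> E} {e \<in> E. x \<in> e}"
  proof (rule bij_betwI')
    fix y z assume "y \<in> {y. {x, y} \<in> E}" "z \<in> {y. {x, y} \<in> E}"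
    then show "({x, y} = {x, z}) = (y = z)" by (auto simp: doubleton_eq_iff)
  next
    fix e assume e: "e \<in> {e \<in> E. x \<in> e}"
    then have "card e = 2" using assms by (auto simp: simple_graph_def)
    then obtain a b where "e = {a, b}" by (auto simp: card_2_iff)
    then show "\<exists>y\<in>{y. {x, y} \<in> E}. e = {x, y}"
      using e by (auto simp: insert_commute)
  qed auto
  then show ?thesis
    by (simp add: bij_betw_same_card vertex_degree_def)
qed

theorem theorem3p1:
  fixes V :: "'a set" and E :: "'a set set" and n k :: nat
  assumes "n \<ge> 10 ^ 9" and "odd n"
    and "even k" and "2 * real n / 5 < real k" and "real k < real n / 2"
    and "card V = n" and "regular_graph k V E"
    and "real (card (triangles V E)) \<le> real k / 4 * (3 * real k - real n - 1)"
  shows "\<exists>D. D \<subseteq> E \<and> real (card D) \<le> 15 / 2 * real k powr (3 / 2) \<and>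
           bipartite_graph V (E - D)"
proof -
  define s where "s = sqrt (real k)"
  define A where "A = (\<lambda>x y. {x, y} \<in> E)"
  have graph: "simple_graph V E" and degree_k: "\<And>v. v \<in> V \<Longrightarrow> vertex_degree E v = k"
    using assms(7) by (auto simp: regular_graph_def)
  have fin: "finite V" and edge: "\<And>e. e \<in> E \<Longrightarrow> e \<subseteq> V \<and> card e = 2"
    using graph by (auto simp: simple_graph_def)
  have loopless: "{x} \<notin> E" for x using edge[of "{x}"] by auto
  have edge_V: "{x, y} \<in> E \<Longrightarrow> x \<in> V" for x y using edge by blast
  interpret regular_adjacency V A k
  proof
    show "card {y. A x y} = k" if "x \<in> V" for x
      using card_neighbours_eq_degree[OF graph, of x] degree_k[OF that] by (simp add: A_def)
  qed (use fin loopless edge_V in \<open>auto simp: A_def insert_commute\<close>)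
  have "s \<ge> 20000"
  proof -
    have "real n \<ge> 10 ^ 9" using assms(1) by (metis of_nat_le_iff of_nat_numeral of_nat_power)
    \<comment> \<open>Here \<open>2 / 5 * 10 ^ 9 = 20000 ^ 2\<close>.\<close>
    then have "20000\<^sup>2 \<le> real k" using assms(4) by simp
    then show ?thesis unfolding s_def by (rule real_le_rsqrt)
  qed
  have dense: "2 * card V + 2 \<le> 5 * k"
  proof -
    \<comment> \<open>Evenness of \<open>k\<close> makes \<open>5 * k - 2 * n\<close> even, so being
      positive it is at least 2.\<close>
    have "2 * n < 5 * k" using assms(4) by linarith
    moreover obtain j where "k = 2 * j" using assms(3) by blast
    ultimately show ?thesis using assms(6) by presburger
  qed
  have sparse: "2 * k \<le> card V" using assms(5,6) by linarith
  have "sum tri V \<le> 6 * card (triangles V E)"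
  proof -
    have "{(x, y, z). {x, y} \<in> E \<and> {x, z} \<in> E \<and> {y, z} \<in> E} = (SIGMA x:V. SIGMA y:N x. N x \<inter> N y)"
    proof -
      have "y \<in> N x \<longleftrightarrow> {x, y} \<in> E" for x y
        unfolding N_def by (simp add: A_def)
      then show ?thesis using edge_V by auto
    qed
    then have "card {(x, y, z). {x, y} \<in> E \<and> {x, z} \<in> E \<and> {y, z} \<in> E} = sum tri V"
      using fin by (simp add: tri_def codeg_def)
    then show ?thesis
      using card_ordered_triangles_le[OF fin loopless edge_V] by simp
  qed
  then have "real (sum tri V) \<le> 6 * real (card (triangles V E))" by linarith
  also have "\<dots> \<le> 3 / 2 * k * (3 * real k - real (card V) - 1)"
    using assms(8) unfolding assms(6) by linarith
  finally have total: "real (sum tri V) \<le> 3 / 2 * k * (3 * real k - real (card V) - 1)" .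
  define B where "B = {v \<in> V. tri v > k * s / 2}"
  define H where "H = {(x, y). A x y \<and> codeg x y > 10 * s}"
  \<comment> \<open>All edges meeting \<open>B\<close>, together with all heavy edges.
    \<open>H\<close> holds both orientations of each heavy edge, so \<open>card H\<close>
    overcounts, but the budget allows it: \<open>3 + 3 / 20\<close> is below
    \<open>15 / 2\<close>.\<close>
  define D where "D = (\<Union>v\<in>B. {e \<in> E. v \<in> e}) \<union> (\<lambda>(x, y). {x, y}) ` H"
  note light = light_part_bipartite[OF dense sparse total, folded s_def, folded B_def,
      OF \<open>s \<ge> 20000\<close>, folded H_def]
  obtain P where P: "A x y \<Longrightarrow> codeg x y \<le> 10 * s \<Longrightarrow> x \<notin> B \<Longrightarrow> y \<notin> B \<Longrightarrow> (x \<in> P) \<noteq> (y \<in> P)"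
    for x y using light(3) by blast
  have finB: "finite B" using fin by (simp add: B_def)
  have finH: "finite H"
    by (rule finite_subset[of _ "V \<times> V"]) (use fin wf sym in \<open>auto simp: H_def\<close>)
  have "card (\<Union>v\<in>B. {e \<in> E. v \<in> e}) \<le> (\<Sum>v\<in>B. vertex_degree E v)"
    unfolding vertex_degree_def by (rule card_UN_le[OF finB])
  also have "\<dots> = card B * k"
    using degree_k by (simp add: B_def)
  finally have "card D \<le> card B * k + card H"
    unfolding D_def using card_image_le[OF finH, of "\<lambda>(x, y). {x, y}"]
    by (intro order_trans[OF card_Un_le] add_mono) auto
  then have "real (card D) \<le> card B * real k + card H"
    by (metis of_nat_add of_nat_le_iff of_nat_mult)
  also have "\<dots> \<le> 3 * s * k + 3 / 20 * k * s"
    using light(1,2) by (intro add_mono mult_right_mono) auto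
  also have "\<dots> \<le> 15 / 2 * (k * s)"
    using \<open>s \<ge> 20000\<close> by (simp add: field_simps)
  also have "k * s = real k powr (3 / 2)"
  proof -
    have "real k powr (3 / 2) = real k powr 1 * real k powr (1 / 2)"
      using powr_add[of "real k" 1 "1 / 2"] by simp
    then show ?thesis by (simp add: s_def powr_half_sqrt)
  qed
  finally have card_D: "real (card D) \<le> 15 / 2 * real k powr (3 / 2)" .
  have "\<exists>a\<in>V \<inter> P. \<exists>b\<in>V - P. e = {a, b}" if e: "e \<in> E - D" for e
  proof -
    obtain x y where xy: "e = {x, y}" using edge[of e] e by (auto simp: card_2_iff)
    have V: "x \<in> V" "y \<in> V" using edge[of e] e xy by auto
    have "A x y" using e xy by (simp add: A_def)
    moreover have "(x, y) \<notin> H" "x \<notin> B" "y \<notin> B" using e xy by (auto simp: D_def)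
    ultimately have "(x \<in> P) \<noteq> (y \<in> P)" by (intro P) (auto simp: H_def)
    then show ?thesis using V xy by (auto simp: insert_commute)
  qed
  then have "bipartite_graph V (E - D)"
    using graph unfolding bipartite_graph_def simple_graph_def
    by (intro conjI exI[of _ "V \<inter> P"] exI[of _ "V - P"]) auto
  moreover have "D \<subseteq> E" by (auto simp: D_def H_def A_def)
  ultimately show ?thesis using card_D by blast
qed

end
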